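(* A quantum graph $\mathcal{S} \subseteq M_n$ is connected if and only if $\sum_{i\neq j} \dim\big[P_j \mathcal{S} P_i\big] \ge 2(m-1)$ whenever $m\in\mathbb{N}$ and $P_1,\dots,P_m\in M_n$ are nontrivial, mutually disjoint projections with $P_1+\dots+P_m=I_n$.
   Context: $M_n$ denotes the $n\times n$ complex matrices, $I_n$ the identity. A projection is $P$ with $P=P^2=P^\dagger$; it is nontrivial if $P\neq 0$ and $P\neq I_n$; projections $P,Q$ are disjoint if $PQ=0$. A quantum graph on $M_n$ is a linear subspace $\mathcal{S}\subseteq M_n$ closed under adjoints and containing $I_n$. $P\mathcal{S}Q=\{PAQ: A\in\mathcal{S}\}$, a linear subspace. For subspaces, $\mathcal{U}\mathcal{V}=\operatorname{span}\{UV: U\in\mathcal{U},V\in\mathcal{V}\}$, $\mathcal{U}^0=\mathbb{C}I_n$, $\mathcal{U}^{k+1}=\mathcal{U}^k\mathcal{U}$. $\mathcal{S}$ is connected if $\mathcal{S}^m=M_n$ for some $m\in\mathbb{N}$. *)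

theory Defs
  imports "HOL-Analysis.Analysis"
begin

text \<open>Matrices in M_n are modelled as complex^'n^'n for a finite index type 'n
(so n = CARD('n) >= 1 is arbitrary). M_n is a complex vector space under
entrywise scalar multiplication mscale.\<close>

type_synonym 'n cmat = "complex ^ 'n ^ 'n"

definition mscale :: "complex \<Rightarrow> 'n::finite cmat \<Rightarrow> 'n cmat" where
  "mscale c A = (\<chi> i j. c * A $ i $ j)"

lemma vector_space_mscale: "vector_space (mscale :: complex \<Rightarrow> 'n::finite cmat \<Rightarrow> 'n cmat)"
  by unfold_locales (auto simp: mscale_def vec_eq_iff algebra_simps)

text \<open>Conjugate transpose.\<close>
definition adj :: "'n::finite cmat \<Rightarrow> 'n cmat" where
  "adj A = (\<chi> i j. cnj (A $ j $ i))"

definition cspan :: "'n::finite cmat set \<Rightarrow> 'n cmat set" where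
  "cspan = module.span mscale"

definition csubspace :: "'n::finite cmat set \<Rightarrow> bool" where
  "csubspace = module.subspace mscale"

text \<open>Complex dimension of a subspace.\<close>
definition cdim :: "'n::finite cmat set \<Rightarrow> nat" where
  "cdim = vector_space.dim mscale"

definition is_projection :: "'n::finite cmat \<Rightarrow> bool" where
  "is_projection P \<longleftrightarrow> P ** P = P \<and> adj P = P"

definition nontrivial_projection :: "'n::finite cmat \<Rightarrow> bool" where
  "nontrivial_projection P \<longleftrightarrow> is_projection P \<and> P \<noteq> 0 \<and> P \<noteq> mat 1"

definition quantum_graph :: "'n::finite cmat set \<Rightarrow> bool" where
  "quantum_graph S \<longleftrightarrow> csubspace S \<and> (\<forall>A\<in>S. adj A \<in> S) \<and> mat 1 \<in> S"

text \<open>P S Q = {P A Q : A in S}.\<close>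
definition sandwich :: "'n::finite cmat \<Rightarrow> 'n cmat set \<Rightarrow> 'n cmat \<Rightarrow> 'n cmat set" where
  "sandwich P S Q = {P ** A ** Q | A. A \<in> S}"

text \<open>Product of subspaces: UV = span{UV}.\<close>
definition subprod :: "'n::finite cmat set \<Rightarrow> 'n cmat set \<Rightarrow> 'n cmat set" where
  "subprod U V = cspan {X ** Y | X Y. X \<in> U \<and> Y \<in> V}"

text \<open>U^0 = C I_n, U^(k+1) = U^k U.\<close>
primrec subpow :: "'n::finite cmat set \<Rightarrow> nat \<Rightarrow> 'n cmat set" where
  "subpow U 0 = cspan {mat 1}"
| "subpow U (Suc k) = subprod (subpow U k) U"

definition qconnected :: "'n::finite cmat set \<Rightarrow> bool" where
  "qconnected S \<longleftrightarrow> (\<exists>m. subpow S m = UNIV)"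

end

theory Submission
  imports Defs
begin

(* A projection commuting with S commutes with every power S^k, so when S is connected it
   commutes with all of M_n and is trivial. Conversely, if only trivial projections commute with
   S, then the unital *-algebra generated by S, the union of the increasing chain S^k, is all of
   M_n by Burnside's theorem (its proof runs through a nonzero Hermitian element of minimal rank,
   which turns out to be a multiple of a rank-one projection), and by finite dimensionality some
   S^k is already M_n.
   The dimension bound expresses the same property. For the blocks Q, 1 - Q it fails exactly when
   Q commutes with S, since S is self-adjoint. For a general partition call blocks i and j
   adjacent when P_j S P_i is nonzero: a cut in this graph would make the sum of the blocks on one
   side a nontrivial projection commuting with S, and a connected graph on m vertices has at least
   2(m - 1) ordered edges, each contributing dimension at least one. *)

interpretation M: vector_space "mscale :: complex \<Rightarrow> 'n::finite cmat \<Rightarrow> 'n cmat"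
  by (rule vector_space_mscale)

section \<open>Matrix units and finite dimensionality\<close>

definition matrix_unit :: "'n::finite \<Rightarrow> 'n \<Rightarrow> 'n cmat" where
  "matrix_unit a b = (\<chi> i j. if i = a \<and> j = b then 1 else 0)"

lemma matrix_unit_expansion:
  "(A::'n::finite cmat) = (\<Sum>a\<in>UNIV. \<Sum>b\<in>UNIV. mscale (A $ a $ b) (matrix_unit a b))"
proof -
  have "(if P \<and> Q then c else 0) = (if P then (if Q then c else 0) else (0::complex))" for P Q c
    by simp
  moreover have "c * (if P then a else 0) = (if P then c * a else (0::complex))" for P a c
    by simp
  moreover have "(\<Sum>y\<in>UNIV. if P then g y else 0) = (if P then (\<Sum>y\<in>UNIV. g y) else (0::complex))"
    for P and g :: "'n \<Rightarrow> complex"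
    by auto
  ultimately show ?thesis
    by (simp add: vec_eq_iff mscale_def matrix_unit_def sum.delta sum.delta' cong: if_cong)
qed

lemma subspace_eq_UNIV_if_matrix_units:
  assumes T: "M.subspace (T :: 'n::finite cmat set)" and units: "\<And>a b. matrix_unit a b \<in> T"
  shows "T = UNIV"
proof -
  have "A \<in> T" for A :: "'n cmat"
  proof -
    have "(\<Sum>a\<in>UNIV. \<Sum>b\<in>UNIV. mscale (A $ a $ b) (matrix_unit a b)) \<in> T"
      by (intro M.subspace_sum[OF T] M.subspace_scale[OF T] units)
    then show ?thesis
      by (simp flip: matrix_unit_expansion)
  qed
  then show ?thesis
    by auto
qed

lemma matrix_units_independent:
  "M.independent (range (\<lambda>(a, b). matrix_unit a b :: 'n::finite cmat))"
proof (rule M.independent_if_scalars_zero)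
  show "finite (range (\<lambda>(a, b). matrix_unit a b :: 'n cmat))"
    by simp
  fix f :: "'n cmat \<Rightarrow> complex" and X :: "'n cmat"
  assume sum_eq: "(\<Sum>Y\<in>range (\<lambda>(a, b). matrix_unit a b). mscale (f Y) Y) = 0"
    and X: "X \<in> range (\<lambda>(a, b). matrix_unit a b)"
  obtain a b where ab: "X = matrix_unit a b"
    using X by auto
  have "(\<Sum>Y\<in>range (\<lambda>(a, b). matrix_unit a b). mscale (f Y) Y) $ a $ b
      = (\<Sum>Y\<in>range (\<lambda>(a, b). matrix_unit a b). f Y * Y $ a $ b)"
    by (simp add: mscale_def)
  also have "\<dots> = (\<Sum>Y\<in>{X}. f Y * Y $ a $ b)"
    using X ab by (intro sum.mono_neutral_right) (auto simp: matrix_unit_def split: if_splits)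
  also have "\<dots> = f X"
    using ab by (simp add: matrix_unit_def)
  finally show "f X = 0"
    using sum_eq by simp
qed

lemma matrix_units_span: "M.span (range (\<lambda>(a, b). matrix_unit a b :: 'n::finite cmat)) = UNIV"
  by (rule subspace_eq_UNIV_if_matrix_units[OF M.subspace_span]) (auto intro: M.span_base)

interpretation MF: finite_dimensional_vector_space "mscale :: complex \<Rightarrow> 'n::finite cmat \<Rightarrow> 'n cmat"
  "range (\<lambda>(a, b). matrix_unit a b)"
  by unfold_locales (auto simp: matrix_units_span matrix_units_independent)

lemma cdim_eq_0_iff: "cdim X = 0 \<longleftrightarrow> X \<subseteq> {0}"
  by (simp add: cdim_def)

lemma commute_matrix_units_imp_scalar:
  assumes "\<And>a b. Q ** matrix_unit a b = matrix_unit a b ** Q"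
  shows "Q = mscale (Q $ k $ k) (mat 1)"
proof -
  define c where "c = Q $ k $ k"
  have "Q $ i $ a = (if i = a then c else 0)" for i a
  proof -
    have "Q $ i $ a = (Q ** matrix_unit a k) $ i $ k"
      by (simp add: matrix_matrix_mult_def matrix_unit_def if_distrib if_distribR sum.delta'
          cong: if_cong)
    also have "\<dots> = (matrix_unit a k ** Q) $ i $ k"
      by (simp only: assms)
    also have "\<dots> = (if i = a then c else 0)"
      by (simp add: matrix_matrix_mult_def matrix_unit_def if_distrib if_distribR sum.delta' c_def
          cong: if_cong)
    finally show ?thesis .
  qed
  then show ?thesis
    by (simp add: vec_eq_iff mscale_def mat_def flip: c_def)
qed

lemma mscale_mult_left: "mscale c A ** B = mscale c (A ** B)"
  by (simp add: mscale_def matrix_matrix_mult_def vec_eq_iff sum_distrib_left mult.assoc)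

lemma mscale_mult_right: "A ** mscale c B = mscale c (A ** B)"
  by (simp add: mscale_def matrix_matrix_mult_def vec_eq_iff sum_distrib_left mult.left_commute)

lemma mscale_mult_vector: "mscale c A *v x = c *s (A *v x)"
  by (simp add: mscale_def matrix_vector_mult_def vec_eq_iff sum_distrib_left mult.assoc)

lemma mscale_add_left: "mscale (c + d) A = mscale c A + mscale d A"
  by (simp add: mscale_def vec_eq_iff algebra_simps)

lemma mscale_mscale: "mscale c (mscale d A) = mscale (c * d) A"
  by (simp add: mscale_def vec_eq_iff)

lemma mscale_one [simp]: "mscale 1 A = A"
  by (simp add: mscale_def vec_eq_iff)

lemma mscale_eq_0_iff: "mscale c A = 0 \<longleftrightarrow> c = 0 \<or> A = 0"
  by (auto simp: mscale_def vec_eq_iff)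

lemma matrix_add_rdistrib: "(B + C) ** A = B ** A + C ** (A::'n::finite cmat)"
  by (simp add: matrix_matrix_mult_def vec_eq_iff sum.distrib distrib_right)

lemma matrix_diff_rdistrib: "(B - C) ** A = B ** A - C ** (A::'n::finite cmat)"
  by (simp add: matrix_matrix_mult_def vec_eq_iff sum_subtractf left_diff_distrib)

lemma matrix_diff_ldistrib: "A ** (B - C) = A ** B - A ** (C::'n::finite cmat)"
  by (simp add: matrix_matrix_mult_def vec_eq_iff sum_subtractf right_diff_distrib)

lemma matrix_mult_sum_left: "(\<Sum>j\<in>J. f j) ** (A::'n::finite cmat) = (\<Sum>j\<in>J. f j ** A)"
  by (induction J rule: infinite_finite_induct) (simp_all add: matrix_add_rdistrib)

lemma matrix_mult_sum_right: "(A::'n::finite cmat) ** (\<Sum>j\<in>J. f j) = (\<Sum>j\<in>J. A ** f j)"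
  by (induction J rule: infinite_finite_induct) (simp_all add: matrix_add_ldistrib)

lemma adj_mult: "adj (A ** B) = adj B ** adj A"
  by (simp add: adj_def matrix_matrix_mult_def vec_eq_iff mult.commute)

lemma adj_adj [simp]: "adj (adj A) = A"
  by (simp add: adj_def vec_eq_iff)

lemma adj_add: "adj (A + B) = adj A + adj B"
  by (simp add: adj_def vec_eq_iff)

lemma adj_diff: "adj (A - B) = adj A - adj B"
  by (simp add: adj_def vec_eq_iff)

lemma adj_mscale: "adj (mscale c A) = mscale (cnj c) (adj A)"
  by (simp add: adj_def mscale_def vec_eq_iff)

lemma adj_mat_1 [simp]: "adj (mat 1 :: 'n::finite cmat) = mat 1"
  by (simp add: adj_def mat_def vec_eq_iff)

lemma adj_0 [simp]: "adj 0 = 0"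
  by (simp add: adj_def vec_eq_iff)

lemma adj_eq_0_iff [simp]: "adj A = 0 \<longleftrightarrow> A = 0"
  by (metis adj_0 adj_adj)

lemma adj_sum: "adj (\<Sum>j\<in>J. f j) = (\<Sum>j\<in>J. adj (f j))"
  by (induction J rule: infinite_finite_induct) (simp_all add: adj_add)

lemma mat_1_neq_0: "(mat 1 :: 'n::finite cmat) \<noteq> 0"
  by (simp add: vec_eq_iff mat_def)

lemma matrix_neq_0_imp_mult_vector_neq_0:
  "(Z::'n::finite cmat) \<noteq> 0 \<Longrightarrow> \<exists>x. Z *v x \<noteq> 0"
  using matrix_eq[of Z 0] by auto

lemma commute_if_off_diagonal_blocks_vanish:
  assumes "Q ** A ** (mat 1 - Q) = 0" and "(mat 1 - Q) ** A ** Q = 0"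
  shows "Q ** A = A ** (Q::'n::finite cmat)"
  using assms by (simp add: matrix_diff_ldistrib matrix_diff_rdistrib matrix_mul_assoc)

section \<open>The inner product on complex column vectors\<close>

definition cinner :: "complex ^ 'n::finite \<Rightarrow> complex ^ 'n \<Rightarrow> complex" where
  "cinner x y = (\<Sum>i\<in>UNIV. cnj (x $ i) * y $ i)"

lemma cinner_adj: "cinner (A *v x) y = cinner x (adj A *v y)"
proof -
  have "cinner (A *v x) y = (\<Sum>i\<in>UNIV. \<Sum>j\<in>UNIV. cnj (A $ i $ j) * cnj (x $ j) * y $ i)"
    by (simp add: cinner_def matrix_vector_mult_def sum_distrib_right)
  also have "\<dots> = (\<Sum>j\<in>UNIV. \<Sum>i\<in>UNIV. cnj (A $ i $ j) * cnj (x $ j) * y $ i)"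
    by (rule sum.swap)
  also have "\<dots> = cinner x (adj A *v y)"
    by (simp add: cinner_def matrix_vector_mult_def adj_def sum_distrib_left mult_ac)
  finally show ?thesis .
qed

lemma cinner_hermitian: "adj A = A \<Longrightarrow> cinner (A *v x) y = cinner x (A *v y)"
  by (simp add: cinner_adj)

lemma cinner_commute: "cinner y x = cnj (cinner x y)"
  by (simp add: cinner_def mult.commute)

lemma cinner_add_left: "cinner (x + y) z = cinner x z + cinner y z"
  by (simp add: cinner_def algebra_simps sum.distrib)

lemma cinner_add_right: "cinner z (x + y) = cinner z x + cinner z y"
  by (simp add: cinner_def algebra_simps sum.distrib)

lemma cinner_diff_right: "cinner z (x - y) = cinner z x - cinner z y"
  by (simp add: cinner_def algebra_simps sum_subtractf)

lemma cinner_scale_left: "cinner (c *s x) z = cnj c * cinner x z"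
  by (simp add: cinner_def algebra_simps sum_distrib_left)

lemma cinner_scale_right: "cinner z (c *s x) = c * cinner z x"
  by (simp add: cinner_def algebra_simps sum_distrib_left)

lemma cinner_zero [simp]: "cinner 0 x = 0" "cinner x 0 = 0"
  by (simp_all add: cinner_def)

lemma cinner_self: "cinner x x = complex_of_real ((norm x)\<^sup>2)"
proof -
  have "cinner x x = (\<Sum>i\<in>UNIV. complex_of_real ((cmod (x $ i))\<^sup>2))"
    by (simp add: cinner_def complex_norm_square[symmetric] mult.commute del: of_real_power)
  also have "\<dots> = complex_of_real ((norm x)\<^sup>2)"
    by (simp add: norm_vec_def L2_set_def sum_nonneg)
  finally show ?thesis .
qed

lemma cinner_self_eq_0 [simp]: "cinner x x = 0 \<longleftrightarrow> x = 0"
  by (simp add: cinner_self)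

lemma cinner_axis_left: "cinner (axis b 1) x = x $ b"
  by (simp add: cinner_def axis_def if_distrib if_distribR cong: if_cong)

lemma hermitian_range_inter_kernel:
  assumes "adj Z = Z" and "Z *v v = 0" and "v \<in> range ((*v) Z)"
  shows "v = 0"
proof -
  obtain x where x: "v = Z *v x"
    using assms(3) by auto
  have "cinner v v = cinner x (Z *v v)"
    using cinner_hermitian[OF assms(1)] x by simp
  then show ?thesis
    using assms(2) by simp
qed

section \<open>Orthogonal projections onto subspaces\<close>

definition outer :: "complex ^ 'n::finite \<Rightarrow> complex ^ 'n \<Rightarrow> 'n cmat" where
  "outer u w = (\<chi> i j. u $ i * cnj (w $ j))"

lemma outer_mult_vector: "outer u w *v x = cinner w x *s u"
  by (simp add: outer_def cinner_def matrix_vector_mult_def vec_eq_iff sum_distrib_left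
      sum_distrib_right mult_ac)

lemma adj_outer_self: "adj (outer u u) = outer u u"
  by (simp add: outer_def adj_def vec_eq_iff mult.commute)

text \<open>Gram--Schmidt: each new generator b adds the rank-one projection onto the component of b
  orthogonal to the span of the previous ones.\<close>

lemma projection_onto_span_exists:
  fixes B :: "(complex ^ 'n::finite) set"
  assumes "finite B"
  shows "\<exists>P. is_projection P \<and> (\<forall>x. P *v x \<in> vec.span B) \<and> (\<forall>w\<in>vec.span B. P *v w = w)"
  using assms
proof (induction B rule: finite_induct)
  case empty
  show ?case
    by (rule exI[of _ 0]) (simp add: is_projection_def)
next
  case (insert b B)
  then obtain P where P: "is_projection P" "\<And>x. P *v x \<in> vec.span B"
    "\<And>w. w \<in> vec.span B \<Longrightarrow> P *v w = w"
    by blast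
  have PP: "P *v (P *v x) = P *v x" for x
    using P by simp
  have P_sym: "cinner (P *v x) y = cinner x (P *v y)" for x y
    using P(1) by (simp add: cinner_hermitian is_projection_def)
  define u where "u = b - P *v b"
  have Pu: "P *v u = 0"
    by (simp add: u_def matrix_vector_mult_diff_distrib PP)
  have span_B: "vec.span B \<subseteq> vec.span (insert b B)"
    by (rule vec.span_mono) auto
  have u_in: "u \<in> vec.span (insert b B)"
    unfolding u_def using span_B P(2)[of b]
    by (intro vec.span_diff) (auto intro: vec.span_base)
  show ?case
  proof (cases "u = 0")
    case True
    then have "b \<in> vec.span B"
      using P(2)[of b] by (simp add: u_def)
    then have "vec.span (insert b B) = vec.span B"
      by (simp add: vec.span_redundant)
    then show ?thesis
      using P by auto
  next
    case False
    define c where "c = cinner u u"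
    have c0: "c \<noteq> 0"
      using False by (simp add: c_def)
    define P' where "P' = P + mscale (1 / c) (outer u u)"
    have P'_mv: "P' *v x = P *v x + (cinner u x / c) *s u" for x
      by (simp add: P'_def matrix_vector_mult_add_rdistrib mscale_mult_vector outer_mult_vector)
    have P'_range: "P' *v x \<in> vec.span (insert b B)" for x
      unfolding P'_mv using span_B P(2)[of x] u_in
      by (intro vec.span_add vec.span_scale) auto
    have P'_fix: "P' *v w = w" if "w \<in> vec.span (insert b B)" for w
    proof -
      have "vec.subspace {w. P' *v w = w}"
        by (auto simp: vec.subspace_def matrix_vector_right_distrib vector_scalar_commute)
      moreover have "insert b B \<subseteq> {w. P' *v w = w}"
      proof
        fix y
        assume y: "y \<in> insert b B"
        show "y \<in> {w. P' *v w = w}"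
        proof (cases "y = b")
          case True
          have "cinner u b = cinner u (u + P *v b)"
            by (simp add: u_def)
          also have "\<dots> = c"
            by (simp add: cinner_add_right c_def P_sym[symmetric] Pu)
          finally show ?thesis
            using True c0 by (simp add: P'_mv u_def)
        next
          case False
          then have yB: "y \<in> vec.span B"
            using y by (auto intro: vec.span_base)
          have "cinner u y = cinner u (P *v y)"
            using P(3)[OF yB] by simp
          also have "\<dots> = 0"
            by (simp add: P_sym[symmetric] Pu)
          finally show ?thesis
            using P(3)[OF yB] by (simp add: P'_mv)
        qed
      qed
      ultimately have "vec.span (insert b B) \<subseteq> {w. P' *v w = w}"
        by (rule vec.span_minimal[rotated])
      then show ?thesis
        using that by auto
    qed
    have "is_projection P'"
      unfolding is_projection_def
    proof
      show "P' ** P' = P'"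
        by (subst matrix_eq) (simp add: matrix_vector_mul_assoc[symmetric] P'_fix P'_range)
      have "cnj (1 / c) = 1 / c"
        by (simp add: c_def cinner_self)
      then show "adj P' = P'"
        using P(1) by (simp add: P'_def adj_add adj_mscale adj_outer_self is_projection_def)
    qed
    then show ?thesis
      using P'_range P'_fix by blast
  qed
qed

lemma projection_onto_subspace_exists:
  fixes W :: "(complex ^ 'n::finite) set"
  assumes "vec.subspace W"
  shows "\<exists>P. is_projection P \<and> (\<forall>x. P *v x \<in> W) \<and> (\<forall>w\<in>W. P *v w = w)"
proof -
  obtain B where B: "B \<subseteq> W" "vec.independent B" "W \<subseteq> vec.span B"
    by (rule vec.basis_exists)
  then have "vec.span B = W"
    using assms vec.span_minimal by blast
  moreover have "finite B"
    using B(2) by (rule vec.finiteI_independent)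
  ultimately show ?thesis
    using projection_onto_span_exists by metis
qed

section \<open>Eigenvectors of Hermitian matrices\<close>

lemma linear_coeff_eq_0_if_nonpos:
  fixes a b :: real
  assumes "\<And>t. a * t + b * t\<^sup>2 \<le> 0"
  shows "a = 0"
proof (rule ccontr)
  assume a0: "a \<noteq> 0"
  define c where "c = \<bar>b\<bar> + 1"
  have c: "c \<ge> 1" "c + b \<ge> 1"
    by (auto simp: c_def)
  have "a * (a / c) + b * (a / c)\<^sup>2 = a\<^sup>2 * (c + b) / c\<^sup>2"
    using c by (simp add: field_simps power2_eq_square)
  also have "\<dots> > 0"
    using a0 c by (intro divide_pos_pos mult_pos_pos) auto
  finally show False
    using assms[of "a / c"] by simp
qed

text \<open>Expand the form at v + t G v for real t: its linear coefficient 2 |G v|^2 must vanish.\<close>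

lemma hermitian_nonpos_form_zero_imp_kernel:
  fixes G :: "'n::finite cmat"
  assumes G: "adj G = G" and R: "vec.subspace R" and GR: "\<And>x. x \<in> R \<Longrightarrow> G *v x \<in> R"
    and nonpos: "\<And>x. x \<in> R \<Longrightarrow> Re (cinner x (G *v x)) \<le> 0"
    and v: "v \<in> R" and v0: "Re (cinner v (G *v v)) = 0"
  shows "G *v v = 0"
proof -
  define w where "w = G *v v"
  have wR: "w \<in> R"
    using GR[OF v] by (simp add: w_def)
  have "cinner v (G *v w) = cnj (cinner w (G *v v))"
    using cinner_hermitian[OF G, of v w] cinner_commute[of w "G *v v"] by simp
  then have sym: "Re (cinner v (G *v w)) = Re (cinner w (G *v v))"
    by simp
  have "2 * Re (cinner w w) * t + Re (cinner w (G *v w)) * t\<^sup>2 \<le> 0" for t :: real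
  proof -
    let ?c = "complex_of_real t"
    have "cinner (v + ?c *s w) (G *v (v + ?c *s w)) =
        cinner v (G *v v) + ?c * cinner v (G *v w) + ?c * cinner w (G *v v)
        + (?c * ?c) * cinner w (G *v w)"
      by (simp add: matrix_vector_right_distrib vector_scalar_commute cinner_add_left
          cinner_add_right cinner_scale_left cinner_scale_right algebra_simps)
    then have "Re (cinner (v + ?c *s w) (G *v (v + ?c *s w))) =
        Re (cinner v (G *v v)) + t * Re (cinner v (G *v w)) + t * Re (cinner w (G *v v))
        + (t * t) * Re (cinner w (G *v w))"
      by simp
    also have "\<dots> = 2 * Re (cinner w w) * t + Re (cinner w (G *v w)) * t\<^sup>2"
      using v0 sym by (simp add: w_def power2_eq_square algebra_simps)
    finally show ?thesis
      using nonpos[of "v + ?c *s w"] R v wR by (simp add: vec.subspace_def)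
  qed
  then have "2 * Re (cinner w w) = 0"
    by (rule linear_coeff_eq_0_if_nonpos)
  then show ?thesis
    by (simp add: w_def cinner_self)
qed

lemma complex_scale_eq_scaleR: "complex_of_real r *s x = r *\<^sub>R (x :: complex ^ 'n::finite)"
  by (simp add: vec_eq_iff) (simp add: scaleR_conv_of_real)

lemma vec_subspace_imp_subspace: "vec.subspace (R :: (complex ^ 'n::finite) set) \<Longrightarrow> subspace R"
  by (auto simp: subspace_def vec.subspace_def complex_scale_eq_scaleR[symmetric])

text \<open>The eigenvector is a maximiser of the Rayleigh quotient on the unit sphere of R.\<close>

lemma hermitian_eigenvector_in_invariant_subspace:
  fixes H :: "'n::finite cmat"
  assumes H: "adj H = H" and R: "vec.subspace R" and HR: "\<And>x. x \<in> R \<Longrightarrow> H *v x \<in> R"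
    and "u \<in> R" "u \<noteq> 0"
  obtains v \<mu> where "v \<in> R" "v \<noteq> 0" "H *v v = complex_of_real \<mu> *s v"
proof -
  define q where "q x = Re (cinner x (H *v x))" for x
  define K where "K = sphere 0 1 \<inter> R"
  have R_scale: "complex_of_real r *s x \<in> R" if "x \<in> R" for r x
    using R that by (simp add: vec.subspace_def)
  have normalised: "complex_of_real (1 / norm x) *s x \<in> K" if "x \<in> R" "x \<noteq> 0" for x
    using R_scale[OF that(1), of "1 / norm x"] that(2)
    unfolding K_def complex_scale_eq_scaleR by simp
  have "closed R"
    using vec_subspace_imp_subspace[OF R] by (rule closed_subspace)
  then have "compact K"
    unfolding K_def by (intro compact_Int_closed) (auto simp: compact_sphere)
  moreover have "K \<noteq> {}"
    using normalised assms(4,5) by blast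
  moreover have "continuous_on K q"
    unfolding q_def cinner_def matrix_vector_mult_def
    by (intro continuous_intros continuous_on_compose2[OF continuous_on_cnj]
        bounded_linear.continuous_on[OF bounded_linear_vec_nth]) auto
  ultimately obtain v where vK: "v \<in> K" and v_max: "\<And>y. y \<in> K \<Longrightarrow> q y \<le> q v"
    using continuous_attains_sup[of K q] by blast
  define \<mu> where "\<mu> = q v"
  define G where "G = H - mscale (complex_of_real \<mu>) (mat 1)"
  have G_mv: "G *v x = H *v x - complex_of_real \<mu> *s x" for x
    by (simp add: G_def matrix_vector_mult_diff_rdistrib mscale_mult_vector)
  have G_form: "Re (cinner x (G *v x)) = q x - \<mu> * (norm x)\<^sup>2" for x
    by (simp add: G_mv cinner_diff_right cinner_scale_right q_def cinner_self)
  have G_adj: "adj G = G"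
    by (simp add: G_def adj_diff adj_mscale H)
  have GR: "G *v x \<in> R" if "x \<in> R" for x
    using HR[OF that] R_scale[OF that] R by (simp add: G_mv vec.subspace_diff)
  have G_nonpos: "Re (cinner x (G *v x)) \<le> 0" if xR: "x \<in> R" for x
  proof (cases "x = 0")
    case False
    define r where "r = 1 / norm x"
    have "q (complex_of_real r *s x) = r\<^sup>2 * q x"
      by (simp add: q_def vector_scalar_commute cinner_scale_left cinner_scale_right
          power2_eq_square)
    then have "r\<^sup>2 * q x \<le> \<mu>"
      using v_max[OF normalised[OF xR False]] by (simp add: \<mu>_def r_def)
    then have "q x \<le> \<mu> * (norm x)\<^sup>2"
      using False by (simp add: r_def field_simps)
    then show ?thesis
      by (simp add: G_form)
  qed simp
  have vR: "v \<in> R" and v_norm: "norm v = 1"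
    using vK by (auto simp: K_def)
  have "Re (cinner v (G *v v)) = 0"
    by (simp add: G_form v_norm \<mu>_def)
  then have "G *v v = 0"
    using hermitian_nonpos_form_zero_imp_kernel[OF G_adj R GR G_nonpos vR] by blast
  then have "H *v v = complex_of_real \<mu> *s v"
    by (simp add: G_mv)
  moreover have "v \<noteq> 0"
    using v_norm by auto
  ultimately show ?thesis
    using vR that by blast
qed

section \<open>Burnside's theorem for unital *-subalgebras\<close>

definition star_subalgebra :: "'n::finite cmat set \<Rightarrow> bool" where
  "star_subalgebra A \<longleftrightarrow> M.subspace A \<and> mat 1 \<in> A \<and> (\<forall>X\<in>A. \<forall>Y\<in>A. X ** Y \<in> A)
     \<and> (\<forall>X\<in>A. adj X \<in> A)"

definition proj_irreducible :: "'n::finite cmat set \<Rightarrow> bool" where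
  "proj_irreducible A \<longleftrightarrow>
     (\<forall>P. is_projection P \<longrightarrow> (\<forall>X\<in>A. P ** X = X ** P) \<longrightarrow> P = 0 \<or> P = mat 1)"

lemma proj_irreducible_mono: "A \<subseteq> B \<Longrightarrow> proj_irreducible A \<Longrightarrow> proj_irreducible B"
  unfolding proj_irreducible_def by blast

lemma star_subalgebraD:
  assumes "star_subalgebra A"
  shows "M.subspace A" "mat 1 \<in> A" "\<And>X Y. X \<in> A \<Longrightarrow> Y \<in> A \<Longrightarrow> X ** Y \<in> A"
    "\<And>X. X \<in> A \<Longrightarrow> adj X \<in> A"
  using assms by (auto simp: star_subalgebra_def)

lemma star_subalgebra_transitive:
  assumes A: "star_subalgebra A" and irr: "proj_irreducible A" and v0: "v \<noteq> 0"
  shows "\<exists>X\<in>A. X *v v = y"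
proof -
  note A' = star_subalgebraD[OF A]
  define W where "W = {X *v v | X. X \<in> A}"
  have "vec.subspace W"
    unfolding vec.subspace_def
  proof (intro conjI ballI allI)
    show "0 \<in> W"
      using M.subspace_0[OF A'(1)] by (force simp: W_def)
    fix c x y
    assume "x \<in> W" "y \<in> W"
    then obtain X Y where "X \<in> A" "Y \<in> A" "x = X *v v" "y = Y *v v"
      by (auto simp: W_def)
    moreover have "x + y = (X + Y) *v v" "c *s x = mscale c X *v v"
      using calculation by (auto simp: matrix_vector_mult_add_rdistrib mscale_mult_vector)
    ultimately show "x + y \<in> W" "c *s x \<in> W"
      unfolding W_def using M.subspace_add[OF A'(1)] M.subspace_scale[OF A'(1)] by blast+
  qed
  then obtain P where P: "is_projection P" "\<And>x. P *v x \<in> W" "\<And>w. w \<in> W \<Longrightarrow> P *v w = w"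
    using projection_onto_subspace_exists by blast
  have invariant: "P ** X ** P = X ** P" if "X \<in> A" for X
  proof (subst matrix_eq, intro allI)
    fix x
    obtain Y where "Y \<in> A" "P *v x = Y *v v"
      using P(2)[of x] by (auto simp: W_def)
    then have "X *v (P *v x) \<in> W"
      using A'(3)[OF that] by (auto simp: W_def matrix_vector_mul_assoc)
    then show "(P ** X ** P) *v x = (X ** P) *v x"
      using P(3) by (simp add: matrix_vector_mul_assoc[symmetric])
  qed
  have "P ** X = X ** P" if "X \<in> A" for X
  proof -
    have "adj (P ** adj X ** P) = adj (adj X ** P)"
      using invariant[OF A'(4)[OF that]] by simp
    then have "P ** X ** P = P ** X"
      using P(1) by (simp add: adj_mult matrix_mul_assoc is_projection_def)
    then show ?thesis
      using invariant[OF that] by simp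
  qed
  moreover have "v \<in> W"
    using A'(2) by (force simp: W_def)
  then have "P \<noteq> 0"
    using P(3) v0 by force
  ultimately have "P = mat 1"
    using irr P(1) by (auto simp: proj_irreducible_def)
  then show ?thesis
    using P(2)[of y] by (auto simp: W_def)
qed

definition crank :: "'n::finite cmat \<Rightarrow> nat" where
  "crank Z = vec.dim (range ((*v) Z))"

lemma crank_less_if_kernel_in_range:
  fixes Z T :: "'n::finite cmat"
  assumes "adj Z = Z" and "range ((*v) Z) \<subseteq> range ((*v) T)"
    and "v \<in> range ((*v) T)" "v \<noteq> 0" "Z *v v = 0"
  shows "crank Z < crank T"
proof -
  have span_range: "vec.span (range ((*v) M)) = range ((*v) M)" for M :: "'n cmat"
    by (simp add: vec.subspace_image)
  have "v \<notin> range ((*v) Z)"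
    using hermitian_range_inter_kernel assms(1,4,5) by blast
  then have "vec.span (range ((*v) Z)) \<subset> vec.span (range ((*v) T))"
    using assms(2,3) unfolding span_range by blast
  then show ?thesis
    unfolding crank_def by (rule vec.dim_psubset)
qed

definition minimal_hermitian :: "'n::finite cmat set \<Rightarrow> 'n cmat \<Rightarrow> bool" where
  "minimal_hermitian A T \<longleftrightarrow> T \<in> A \<and> adj T = T \<and> T \<noteq> 0 \<and>
     (\<forall>Z\<in>A. adj Z = Z \<longrightarrow> Z \<noteq> 0 \<longrightarrow> crank T \<le> crank Z)"

lemma minimal_hermitian_exists:
  assumes "star_subalgebra A"
  shows "\<exists>T. minimal_hermitian A T"
proof -
  have "mat 1 \<in> {Z \<in> A. adj Z = Z \<and> Z \<noteq> 0}"
    using assms mat_1_neq_0 by (simp add: star_subalgebra_def)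
  then show ?thesis
    using ex_has_least_nat[of "\<lambda>Z. Z \<in> {Z \<in> A. adj Z = Z \<and> Z \<noteq> 0}" "mat 1" crank]
    unfolding minimal_hermitian_def by blast
qed

lemma minimal_hermitian_kernel_eq_0:
  assumes T: "minimal_hermitian A T" and Z: "Z \<in> A" "adj Z = Z"
    and "range ((*v) Z) \<subseteq> range ((*v) T)" "v \<in> range ((*v) T)" "v \<noteq> 0" "Z *v v = 0"
  shows "Z = 0"
proof (rule ccontr)
  assume "Z \<noteq> 0"
  then have "crank T \<le> crank Z"
    using T Z by (simp add: minimal_hermitian_def)
  moreover have "crank Z < crank T"
    using crank_less_if_kernel_in_range Z(2) assms(4-) by blast
  ultimately show False
    by simp
qed

lemma hermitian_eigenvector_in_range:
  fixes L T :: "'n::finite cmat"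
  assumes "adj L = L" and "range ((*v) L) \<subseteq> range ((*v) T)" and "T \<noteq> 0"
  obtains w \<mu> where "w \<in> range ((*v) T)" "w \<noteq> 0" "L *v w = complex_of_real \<mu> *s w"
proof -
  obtain x where "T *v x \<noteq> 0"
    using matrix_neq_0_imp_mult_vector_neq_0[OF assms(3)] by blast
  with assms(2) show ?thesis
    using hermitian_eigenvector_in_invariant_subspace[OF assms(1)
        vec.subspace_image[OF vec.subspace_UNIV], where u = "T *v x"] that
    by blast
qed

text \<open>If T v = \<mu> v with v in the range of T, then T T - \<mu> T kills v, so it vanishes by
  minimality; hence T / \<mu> is a projection.\<close>

lemma minimal_projection_exists:
  assumes A: "star_subalgebra A"
  obtains E where "minimal_hermitian A E" "is_projection E"
proof -
  note A' = star_subalgebraD[OF A]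
  obtain T where T: "minimal_hermitian A T"
    using minimal_hermitian_exists[OF A] by blast
  then have TA: "T \<in> A" and T_adj: "adj T = T" and T0: "T \<noteq> 0"
    by (auto simp: minimal_hermitian_def)
  obtain v \<mu> where vR: "v \<in> range ((*v) T)" and v0: "v \<noteq> 0"
    and Tv: "T *v v = complex_of_real \<mu> *s v"
    using hermitian_eigenvector_in_range[OF T_adj order_refl T0] by blast
  have \<mu>0: "\<mu> \<noteq> 0"
    using hermitian_range_inter_kernel[OF T_adj _ vR] v0 Tv by auto
  define Z where "Z = T ** T - mscale (complex_of_real \<mu>) T"
  have Z_mv: "Z *v x = T *v (T *v x - complex_of_real \<mu> *s x)" for x
    by (simp add: Z_def matrix_vector_mult_diff_rdistrib matrix_vector_mult_diff_distrib
        mscale_mult_vector vector_scalar_commute matrix_vector_mul_assoc)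
  have "Z = 0"
  proof (rule minimal_hermitian_kernel_eq_0[OF T _ _ _ vR v0])
    show "Z \<in> A"
      unfolding Z_def using A'(3)[OF TA TA] M.subspace_scale[OF A'(1) TA]
      by (rule M.subspace_diff[OF A'(1)])
    show "adj Z = Z"
      by (simp add: Z_def adj_diff adj_mult adj_mscale T_adj)
  qed (auto simp: Z_mv Tv vector_scalar_commute)
  then have TT: "T ** T = mscale (complex_of_real \<mu>) T"
    by (simp add: Z_def)
  define E where "E = mscale (complex_of_real (1 / \<mu>)) T"
  have E_mv: "E *v x = T *v (complex_of_real (1 / \<mu>) *s x)"
    and T_mv: "T *v x = E *v (complex_of_real \<mu> *s x)" for x
    using \<mu>0 by (simp_all add: E_def mscale_mult_vector vector_scalar_commute)
  have "range ((*v) E) = range ((*v) T)"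
    by (auto simp: image_iff) (metis E_mv, metis T_mv)
  moreover have "E \<in> A"
    unfolding E_def by (rule M.subspace_scale[OF A'(1) TA])
  moreover have "adj E = E" and "E \<noteq> 0"
    using T_adj T0 \<mu>0 by (simp_all add: E_def adj_mscale mscale_eq_0_iff)
  ultimately have "minimal_hermitian A E"
    using T by (auto simp: minimal_hermitian_def crank_def)
  moreover have "E ** E = E"
    using \<mu>0 by (simp add: E_def mscale_mult_left mscale_mult_right TT mscale_mscale
        power2_eq_square)
  ultimately show ?thesis
    using that \<open>adj E = E\<close> by (simp add: is_projection_def)
qed

lemma minimal_projection_compress_hermitian:
  assumes A: "star_subalgebra A" and E: "minimal_hermitian A E" "is_projection E"
    and Y: "Y \<in> A" "adj Y = Y"
  shows "\<exists>c. E ** Y ** E = mscale c E"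
proof -
  note A' = star_subalgebraD[OF A]
  have EA: "E \<in> A" and E0: "E \<noteq> 0" and E_adj: "adj E = E" and EE: "E ** E = E"
    using E by (auto simp: minimal_hermitian_def is_projection_def)
  define L where "L = E ** Y ** E"
  have LA: "L \<in> A"
    unfolding L_def using A'(3) EA Y(1) by blast
  have L_adj: "adj L = L"
    by (simp add: L_def adj_mult E_adj Y(2) matrix_mul_assoc)
  have L_mv: "L *v x = E *v ((Y ** E) *v x)" for x
    by (simp add: L_def matrix_vector_mul_assoc matrix_mul_assoc)
  then obtain w \<mu> where wR: "w \<in> range ((*v) E)" and w0: "w \<noteq> 0"
    and Lw: "L *v w = complex_of_real \<mu> *s w"
    using hermitian_eigenvector_in_range[OF L_adj _ E0] by blast
  have Ew: "E *v w = w"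
    using wR by (auto simp: matrix_vector_mul_assoc EE)
  define Z where "Z = L - mscale (complex_of_real \<mu>) E"
  have Z_mv: "Z *v x = E *v ((Y ** E) *v x - complex_of_real \<mu> *s x)" for x
    by (simp add: Z_def L_mv matrix_vector_mult_diff_rdistrib matrix_vector_mult_diff_distrib
        mscale_mult_vector vector_scalar_commute)
  have "Z = 0"
  proof (rule minimal_hermitian_kernel_eq_0[OF E(1) _ _ _ wR w0])
    show "Z \<in> A"
      unfolding Z_def using LA M.subspace_scale[OF A'(1) EA] by (rule M.subspace_diff[OF A'(1)])
    show "adj Z = Z"
      by (simp add: Z_def adj_diff L_adj adj_mscale E_adj)
    show "Z *v w = 0"
      by (simp add: Z_def matrix_vector_mult_diff_rdistrib Lw mscale_mult_vector Ew)
  qed (auto simp: Z_mv)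
  then show ?thesis
    by (auto simp: Z_def L_def)
qed

lemma minimal_projection_compress:
  assumes A: "star_subalgebra A" and E: "minimal_hermitian A E" "is_projection E"
    and Y: "Y \<in> A"
  shows "\<exists>c. E ** Y ** E = mscale c E"
proof -
  note A' = star_subalgebraD[OF A]
  define H1 where "H1 = mscale (1 / 2) (Y + adj Y)"
  define H2 where "H2 = mscale (- \<i> / 2) (Y - adj Y)"
  have "H1 \<in> A" "H2 \<in> A"
    unfolding H1_def H2_def
    by (intro M.subspace_scale[OF A'(1)] M.subspace_add[OF A'(1)] M.subspace_diff[OF A'(1)]
        Y A'(4)[OF Y])+
  moreover have "adj H1 = H1" "adj H2 = H2"
    by (simp_all add: H1_def H2_def adj_def mscale_def vec_eq_iff algebra_simps)
  ultimately obtain c1 c2 where c1: "E ** H1 ** E = mscale c1 E" and c2: "E ** H2 ** E = mscale c2 E"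
    using minimal_projection_compress_hermitian[OF A E] by meson
  have "Y = H1 + mscale \<i> H2"
    by (simp add: H1_def H2_def mscale_def vec_eq_iff algebra_simps)
  then have "E ** Y ** E = E ** H1 ** E + mscale \<i> (E ** H2 ** E)"
    by (simp add: matrix_add_ldistrib matrix_add_rdistrib mscale_mult_left mscale_mult_right)
  also have "\<dots> = mscale (c1 + \<i> * c2) E"
    by (simp add: c1 c2 mscale_mscale mscale_add_left)
  finally show ?thesis
    by blast
qed

text \<open>By transitivity some X in A maps e to E x; as E X E is a multiple of E, so is E x of e.\<close>

lemma minimal_projection_rank_one:
  assumes A: "star_subalgebra A" "proj_irreducible A"
    and E: "minimal_hermitian A E" "is_projection E"
  obtains e where "e \<noteq> 0" "\<And>x. E *v x = (cinner e x / cinner e e) *s e"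
proof -
  have E0: "E \<noteq> 0" and E_adj: "adj E = E" and EE: "E ** E = E"
    using E by (auto simp: minimal_hermitian_def is_projection_def)
  have E_idem: "E *v (E *v x) = E *v x" for x
    by (simp add: matrix_vector_mul_assoc EE)
  obtain x0 where x0: "E *v x0 \<noteq> 0"
    using matrix_neq_0_imp_mult_vector_neq_0[OF E0] by blast
  define e where "e = E *v x0"
  have e0: "e \<noteq> 0" and Ee: "E *v e = e"
    using x0 by (simp_all add: e_def E_idem)
  have "E *v x = (cinner e x / cinner e e) *s e" for x
  proof -
    obtain X where XA: "X \<in> A" and Xe: "X *v e = E *v x"
      using star_subalgebra_transitive[OF A e0] by blast
    obtain c where c: "E ** X ** E = mscale c E"
      using minimal_projection_compress[OF A(1) E XA] by blast
    have "(E ** X ** E) *v e = E *v x"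
      by (simp add: matrix_vector_mul_assoc[symmetric] Ee Xe E_idem)
    then have Ex: "E *v x = c *s e"
      by (simp add: c mscale_mult_vector Ee)
    have "cinner e (E *v x) = cinner e x"
      using cinner_hermitian[OF E_adj, of e x] Ee by simp
    then have "c = cinner e x / cinner e e"
      using e0 by (simp add: Ex cinner_scale_right field_simps)
    then show ?thesis
      using Ex by simp
  qed
  with e0 show ?thesis
    using that by blast
qed

text \<open>With E the projection onto the line through e, and X e, Y e the standard basis vectors
  a and b (transitivity), the matrix unit of (a, b) is a multiple of X E (adj Y).\<close>

theorem star_subalgebra_eq_UNIV_if_proj_irreducible:
  assumes A: "star_subalgebra A" and irr: "proj_irreducible A"
  shows "A = UNIV"
proof -
  note A' = star_subalgebraD[OF A]
  obtain E where E: "minimal_hermitian A E" "is_projection E"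
    using minimal_projection_exists[OF A] by blast
  then have EA: "E \<in> A"
    by (simp add: minimal_hermitian_def)
  obtain e where e0: "e \<noteq> 0" and E_mv: "\<And>x. E *v x = (cinner e x / cinner e e) *s e"
    using minimal_projection_rank_one[OF A irr E] by blast
  have "matrix_unit a b \<in> A" for a b
  proof -
    obtain X Y where XA: "X \<in> A" and Xe: "X *v e = axis a 1"
      and YA: "Y \<in> A" and Ye: "Y *v e = axis b 1"
      using star_subalgebra_transitive[OF A irr e0] by meson
    have "mscale (cinner e e) (X ** E ** adj Y) \<in> A"
      using A'(3) A'(4)[OF YA] XA EA by (blast intro: M.subspace_scale[OF A'(1)])
    moreover have "mscale (cinner e e) (X ** E ** adj Y) = matrix_unit a b"
    proof (subst matrix_eq, intro allI)
      fix x
      have "cinner e (adj Y *v x) = x $ b"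
        using cinner_adj[of Y e x] Ye cinner_axis_left[of b x] by simp
      then have "mscale (cinner e e) (X ** E ** adj Y) *v x = x $ b *s axis a 1"
        using e0 by (simp add: mscale_mult_vector matrix_vector_mul_assoc[symmetric] E_mv
            vector_scalar_commute Xe)
      also have "\<dots> = matrix_unit a b *v x"
        by (simp add: matrix_unit_def matrix_vector_mult_def vec_eq_iff axis_def if_distrib
            if_distribR cong: if_cong)
      finally show "mscale (cinner e e) (X ** E ** adj Y) *v x = matrix_unit a b *v x" .
    qed
    ultimately show ?thesis
      by simp
  qed
  then show ?thesis
    by (rule subspace_eq_UNIV_if_matrix_units[OF A'(1)])
qed

section \<open>Powers of a quantum graph and the algebra they generate\<close>

lemma subpow_0: "subpow S 0 = range (\<lambda>c. mscale c (mat 1))"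
  by (simp add: cspan_def M.span_singleton)

lemma subpow_Suc_eq_span: "subpow S (Suc k) = M.span {X ** Y | X Y. X \<in> subpow S k \<and> Y \<in> S}"
  by (simp add: subprod_def cspan_def)

declare subpow.simps [simp del]

lemma subpow_subspace: "M.subspace (subpow S k)"
  by (cases k) (simp_all add: subpow_0 subpow_Suc_eq_span flip: M.span_singleton)

lemma subpow_Suc_mult: "X \<in> subpow S k \<Longrightarrow> Y \<in> S \<Longrightarrow> X ** Y \<in> subpow S (Suc k)"
  unfolding subpow_Suc_eq_span by (rule M.span_base) blast

lemma subpow_mono:
  assumes "mat 1 \<in> S" and "k \<le> l"
  shows "subpow S k \<subseteq> subpow S l"
  using lift_Suc_mono_le[of "subpow S", OF _ assms(2)] subpow_Suc_mult[of _ S _ "mat 1"] assms(1)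
  by force

lemma subset_subpow_1: "S \<subseteq> subpow S 1"
  using subpow_Suc_mult[of "mat 1" S 0] by (force simp: subpow_0 intro: range_eqI[of _ _ 1])

lemma subpow_add: "X \<in> subpow S a \<Longrightarrow> Y \<in> subpow S b \<Longrightarrow> X ** Y \<in> subpow S (a + b)"
proof (induction b arbitrary: Y)
  case 0
  then obtain c where "Y = mscale c (mat 1)"
    by (auto simp: subpow_0)
  then show ?case
    using M.subspace_scale[OF subpow_subspace 0(1)] by (simp add: mscale_mult_right)
next
  case (Suc b)
  have "M.subspace {Y. X ** Y \<in> subpow S (a + Suc b)}"
    using M.subspace_0[OF subpow_subspace] M.subspace_add[OF subpow_subspace]
      M.subspace_scale[OF subpow_subspace]
    by (auto simp: M.subspace_def matrix_add_ldistrib mscale_mult_right)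
  moreover have "X ** (Z ** W) \<in> subpow S (a + Suc b)" if "Z \<in> subpow S b" "W \<in> S" for Z W
    using subpow_Suc_mult[OF Suc.IH[OF Suc.prems(1) that(1)] that(2)]
    by (simp add: matrix_mul_assoc)
  ultimately have "subpow S (Suc b) \<subseteq> {Y. X ** Y \<in> subpow S (a + Suc b)}"
    unfolding subpow_Suc_eq_span by (intro M.span_minimal) auto
  then show ?case
    using Suc.prems(2) by blast
qed

lemma subpow_subset_subalgebra:
  assumes T: "M.subspace T" "mat 1 \<in> T" "S \<subseteq> T" and mult: "\<And>X Y. X \<in> T \<Longrightarrow> Y \<in> T \<Longrightarrow> X ** Y \<in> T"
  shows "subpow S k \<subseteq> T"
proof (induction k)
  case 0
  show ?case
    using M.subspace_scale[OF T(1,2)] by (auto simp: subpow_0)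
next
  case (Suc k)
  then show ?case
    unfolding subpow_Suc_eq_span using T(3) by (intro M.span_minimal[OF _ T(1)]) (auto intro: mult)
qed

lemma subpow_commute:
  assumes "\<And>A. A \<in> S \<Longrightarrow> Q ** A = A ** Q" and "X \<in> subpow S k"
  shows "Q ** X = X ** Q"
proof -
  have "subpow S k \<subseteq> {X. Q ** X = X ** Q}"
  proof (rule subpow_subset_subalgebra)
    show "M.subspace {X. Q ** X = X ** Q}"
      by (auto simp: M.subspace_def matrix_add_ldistrib matrix_add_rdistrib mscale_mult_right
          mscale_mult_left)
  qed (auto simp: assms(1), metis matrix_mul_assoc)
  then show ?thesis
    using assms(2) by blast
qed

lemma star_subalgebra_Union_subpow:
  assumes "quantum_graph S"
  shows "star_subalgebra (\<Union>k. subpow S k)"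
proof -
  define A where "A = (\<Union>k. subpow S k)"
  have one: "mat 1 \<in> S" and adj_S: "\<And>X. X \<in> S \<Longrightarrow> adj X \<in> S"
    using assms by (auto simp: quantum_graph_def)
  have common: "\<exists>k. X \<in> subpow S k \<and> Y \<in> subpow S k" if "X \<in> A" "Y \<in> A" for X Y
    using that subpow_mono[OF one max.cobounded1] subpow_mono[OF one max.cobounded2]
    unfolding A_def by blast
  have subspace: "M.subspace A"
    unfolding M.subspace_def
  proof (intro conjI ballI allI)
    show "0 \<in> A"
      using M.subspace_0[OF subpow_subspace] by (auto simp: A_def)
    fix c X Y
    assume "X \<in> A" "Y \<in> A"
    then obtain k where "X \<in> subpow S k" "Y \<in> subpow S k"
      using common by blast
    then have "X + Y \<in> subpow S k" "mscale c X \<in> subpow S k"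
      by (simp_all add: M.subspace_add[OF subpow_subspace] M.subspace_scale[OF subpow_subspace])
    then show "X + Y \<in> A" "mscale c X \<in> A"
      by (auto simp: A_def)
  qed
  have mult: "X ** Y \<in> A" if XY: "X \<in> A" "Y \<in> A" for X Y
  proof -
    obtain a b where "X \<in> subpow S a" "Y \<in> subpow S b"
      using XY unfolding A_def by blast
    then show ?thesis
      unfolding A_def using subpow_add by blast
  qed
  have S_A: "S \<subseteq> A"
    using subset_subpow_1 by (auto simp: A_def)
  have one_A: "mat 1 \<in> A"
    using S_A one by blast
  have adj_closed: "subpow S k \<subseteq> {X \<in> A. adj X \<in> A}" for k
  proof (rule subpow_subset_subalgebra)
    show "M.subspace {X \<in> A. adj X \<in> A}"
      using M.subspace_0[OF subspace] M.subspace_add[OF subspace] M.subspace_scale[OF subspace]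
      by (auto simp: M.subspace_def adj_add adj_mscale)
    show "mat 1 \<in> {X \<in> A. adj X \<in> A}"
      using one_A by simp
    show "S \<subseteq> {X \<in> A. adj X \<in> A}"
      using S_A adj_S by blast
    show "X ** Y \<in> {X \<in> A. adj X \<in> A}" if "X \<in> {X \<in> A. adj X \<in> A}" "Y \<in> {X \<in> A. adj X \<in> A}"
      for X Y
      using that mult by (simp add: adj_mult)
  qed
  have "adj X \<in> A" if X: "X \<in> A" for X
  proof -
    obtain k where "X \<in> subpow S k"
      using X unfolding A_def by blast
    then show ?thesis
      using adj_closed by blast
  qed
  then show ?thesis
    using subspace one_A mult unfolding star_subalgebra_def A_def[symmetric] by blast
qed

lemma qconnected_if_Union_subpow_eq_UNIV:
  assumes one: "mat 1 \<in> S" and A: "(\<Union>k. subpow S k) = UNIV"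
  shows "qconnected S"
proof -
  have "\<forall>a b. \<exists>k. matrix_unit a b \<in> subpow S k"
    using A by blast
  then obtain f where f: "\<And>a b. matrix_unit a b \<in> subpow S (f a b)"
    by metis
  define K where "K = Max (range (case_prod f))"
  have "f a b \<le> K" for a b
    unfolding K_def by (rule Max_ge) auto
  then have "matrix_unit a b \<in> subpow S K" for a b
    using f subpow_mono[OF one] by blast
  then have "subpow S K = UNIV"
    by (rule subspace_eq_UNIV_if_matrix_units[OF subpow_subspace])
  then show ?thesis
    unfolding qconnected_def by blast
qed

lemma scalar_projection_trivial:
  assumes "is_projection (mscale c (mat 1 :: 'n::finite cmat))"
  shows "c = 0 \<or> c = 1"
proof -
  have "mscale (c * c) (mat 1 :: 'n cmat) = mscale c (mat 1)"
    using assms by (simp add: is_projection_def mscale_mult_left mscale_mult_right mscale_mscale)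
  then have "(mscale (c * c) (mat 1 :: 'n cmat)) $ undefined $ undefined
      = (mscale c (mat 1 :: 'n cmat)) $ undefined $ undefined"
    by (rule arg_cong[where f = "\<lambda>M. M $ undefined $ undefined"])
  then have "c * c = c"
    by (simp add: mscale_def mat_def)
  then show ?thesis
    by (metis mult_cancel_right1 mult_eq_0_iff)
qed

lemma qconnected_imp_proj_irreducible:
  fixes S :: "'n::finite cmat set"
  assumes "qconnected S"
  shows "proj_irreducible S"
  unfolding proj_irreducible_def
proof (intro allI impI)
  fix P :: "'n cmat"
  assume P: "is_projection P" and comm: "\<forall>X\<in>S. P ** X = X ** P"
  obtain N where "subpow S N = UNIV"
    using assms by (auto simp: qconnected_def)
  then have "P ** matrix_unit a b = matrix_unit a b ** P" for a b
    using subpow_commute comm by blast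
  then have P_scalar: "P = mscale (P $ undefined $ undefined) (mat 1)"
    by (rule commute_matrix_units_imp_scalar)
  then show "P = 0 \<or> P = mat 1"
    using scalar_projection_trivial P by (metis mscale_eq_0_iff mscale_one)
qed

lemma proj_irreducible_imp_qconnected:
  fixes S :: "'n::finite cmat set"
  assumes S: "quantum_graph S" and irr: "proj_irreducible S"
  shows "qconnected S"
proof -
  have "S \<subseteq> (\<Union>k. subpow S k)"
    using subset_subpow_1 by blast
  then have "proj_irreducible (\<Union>k. subpow S k)"
    using irr by (rule proj_irreducible_mono)
  then have "(\<Union>k. subpow S k) = UNIV"
    using star_subalgebra_eq_UNIV_if_proj_irreducible star_subalgebra_Union_subpow[OF S] by blast
  then show ?thesis
    using S by (intro qconnected_if_Union_subpow_eq_UNIV) (auto simp: quantum_graph_def)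
qed

section \<open>Counting ordered edges of a connected graph\<close>

definition arcs :: "('a \<Rightarrow> 'a \<Rightarrow> bool) \<Rightarrow> 'a set \<Rightarrow> ('a \<times> 'a) set" where
  "arcs E C = {(i, j). i \<in> C \<and> j \<in> C \<and> i \<noteq> j \<and> E i j}"

text \<open>Grow a vertex set one neighbour at a time: every new vertex brings a new edge, counted
  in both directions.\<close>

lemma connected_subgraph_card_arcs:
  assumes V: "finite V" and sym: "\<And>i j. E i j \<Longrightarrow> E j i"
    and conn: "\<And>J. J \<subseteq> V \<Longrightarrow> J \<noteq> {} \<Longrightarrow> J \<noteq> V \<Longrightarrow> \<exists>j\<in>J. \<exists>i\<in>V - J. E i j"
    and k: "1 \<le> k" "k \<le> card V"
  shows "\<exists>C\<subseteq>V. card C = k \<and> 2 * (k - 1) \<le> card (arcs E C)"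
  using k
proof (induction k rule: dec_induct)
  case base
  obtain x where "x \<in> V"
    using k by fastforce
  then show ?case
    by (intro exI[of _ "{x}"]) auto
next
  case (step k)
  then obtain C where C: "C \<subseteq> V" "card C = k" "2 * (k - 1) \<le> card (arcs E C)"
    by auto
  have "C \<noteq> {}" "C \<noteq> V"
    using C(2) step by auto
  then obtain j i where j: "j \<in> C" and i: "i \<in> V - C" and Eij: "E i j"
    using conn[OF C(1)] by blast
  have fin: "finite (arcs E D)" if "D \<subseteq> V" for D
    by (rule finite_subset[of _ "V \<times> V"]) (use that V in \<open>auto simp: arcs_def\<close>)
  have "(i, j) \<notin> arcs E C" "(j, i) \<notin> arcs E C" "(i, j) \<noteq> (j, i)"
    using i j by (auto simp: arcs_def)
  then have "card (arcs E C) + 2 = card (insert (i, j) (insert (j, i) (arcs E C)))"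
    using fin[OF C(1)] by simp
  also have "\<dots> \<le> card (arcs E (insert i C))"
    using C(1) i j Eij sym[OF Eij] fin[of "insert i C"]
    by (intro card_mono) (auto simp: arcs_def)
  finally have "2 * (Suc k - 1) \<le> card (arcs E (insert i C))"
    using C(3) step by simp
  moreover have "card (insert i C) = Suc k"
    using C(1,2) i V finite_subset by fastforce
  ultimately show ?case
    using C(1) i by (intro exI[of _ "insert i C"]) auto
qed

lemma connected_graph_card_arcs:
  assumes V: "finite V" and sym: "\<And>i j. E i j \<Longrightarrow> E j i"
    and conn: "\<And>J. J \<subseteq> V \<Longrightarrow> J \<noteq> {} \<Longrightarrow> J \<noteq> V \<Longrightarrow> \<exists>j\<in>J. \<exists>i\<in>V - J. E i j"
  shows "2 * (card V - 1) \<le> card (arcs E V)"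
proof (cases "V = {}")
  case False
  then have "1 \<le> card V"
    using V by (simp add: Suc_le_eq card_gt_0_iff)
  then obtain C where "C \<subseteq> V" "card C = card V" "2 * (card V - 1) \<le> card (arcs E C)"
    using connected_subgraph_card_arcs[OF assms] by blast
  then show ?thesis
    using card_subset_eq[OF V] by metis
qed simp

section \<open>Partitions of the identity into projections\<close>

definition proj_partition :: "nat \<Rightarrow> (nat \<Rightarrow> 'n::finite cmat) \<Rightarrow> bool" where
  "proj_partition m P \<longleftrightarrow> (\<forall>i\<in>{1..m}. nontrivial_projection (P i))
     \<and> (\<forall>i\<in>{1..m}. \<forall>j\<in>{1..m}. i \<noteq> j \<longrightarrow> P i ** P j = 0) \<and> (\<Sum>i\<in>{1..m}. P i) = mat 1"

definition block_dim_sum :: "'n::finite cmat set \<Rightarrow> nat \<Rightarrow> (nat \<Rightarrow> 'n cmat) \<Rightarrow> nat" where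
  "block_dim_sum S m P = (\<Sum>(i, j)\<in>{(i, j). i \<in> {1..m} \<and> j \<in> {1..m} \<and> i \<noteq> j}.
     cdim (sandwich (P j) S (P i)))"

lemma proj_partition_mult:
  assumes P: "proj_partition m P" and "i \<in> {1..m}" "j \<in> {1..m}"
  shows "P j ** P i = (if j = i then P i else 0)"
  using assms by (simp add: proj_partition_def nontrivial_projection_def is_projection_def)

lemma proj_partition_sum_mult:
  assumes P: "proj_partition m P" and J: "J \<subseteq> {1..m}" and i: "i \<in> {1..m}"
  shows "(\<Sum>j\<in>J. P j) ** P i = (if i \<in> J then P i else 0)"
proof -
  have "finite J"
    using J finite_subset by blast
  have "(\<Sum>j\<in>J. P j) ** P i = (\<Sum>j\<in>J. if j = i then P i else 0)"
    unfolding matrix_mult_sum_left using J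
    by (intro sum.cong refl) (simp add: proj_partition_mult[OF P i] subset_iff)
  also have "\<dots> = (if i \<in> J then P i else 0)"
    using \<open>finite J\<close> by simp
  finally show ?thesis .
qed

lemma proj_partition_sum_is_projection:
  assumes P: "proj_partition m P" and J: "J \<subseteq> {1..m}"
  shows "is_projection (\<Sum>j\<in>J. P j)"
proof -
  have "(\<Sum>j\<in>J. P j) ** (\<Sum>i\<in>J. P i) = (\<Sum>i\<in>J. P i)"
    unfolding matrix_mult_sum_right using J
    by (intro sum.cong refl) (simp add: proj_partition_sum_mult[OF P J] subset_iff)
  moreover have "adj (P j) = P j" if "j \<in> J" for j
    using P J that by (auto simp: proj_partition_def nontrivial_projection_def is_projection_def)
  then have "adj (\<Sum>j\<in>J. P j) = (\<Sum>j\<in>J. P j)"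
    unfolding adj_sum by (rule sum.cong[OF refl])
  ultimately show ?thesis
    by (simp add: is_projection_def)
qed

text \<open>If no block of J is linked through S to a block outside J, then the sum of the blocks of
  J is a projection commuting with S.\<close>

lemma proj_partition_cut_edge:
  assumes S: "quantum_graph S" and irr: "proj_irreducible S" and P: "proj_partition m P"
    and J: "J \<subseteq> {1..m}" "J \<noteq> {}" "J \<noteq> {1..m}"
  shows "\<exists>j\<in>J. \<exists>i\<in>{1..m} - J. \<exists>A\<in>S. P j ** A ** P i \<noteq> 0"
proof (rule ccontr)
  assume no_edge: "\<not> ?thesis"
  define Q where "Q = (\<Sum>j\<in>J. P j)"
  have Q_compl: "mat 1 - Q = (\<Sum>i\<in>{1..m} - J. P i)"
    using P sum.subset_diff[OF J(1), of P] by (simp add: Q_def proj_partition_def)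
  have zero: "P j ** A ** P i = 0" "P i ** A ** P j = 0"
    if "j \<in> J" "i \<in> {1..m} - J" "A \<in> S" for i j A
  proof -
    show "P j ** A ** P i = 0"
      using no_edge that by blast
    have "adj A \<in> S"
      using S that(3) by (simp add: quantum_graph_def)
    then have "P j ** adj A ** P i = 0"
      using no_edge that by blast
    moreover have "adj (P j ** adj A ** P i) = P i ** A ** P j"
      using P J(1) that(1,2)
      by (auto simp: adj_mult matrix_mul_assoc proj_partition_def nontrivial_projection_def
          is_projection_def)
    ultimately show "P i ** A ** P j = 0"
      by simp
  qed
  have "Q ** A = A ** Q" if "A \<in> S" for A
  proof (rule commute_if_off_diagonal_blocks_vanish)
    show "Q ** A ** (mat 1 - Q) = 0" "(mat 1 - Q) ** A ** Q = 0"
      unfolding Q_compl unfolding Q_def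
      by (simp_all add: matrix_mult_sum_left matrix_mult_sum_right zero that)
  qed
  moreover have "is_projection Q"
    unfolding Q_def using P J(1) by (rule proj_partition_sum_is_projection)
  ultimately have "Q = 0 \<or> Q = mat 1"
    using irr by (simp add: proj_irreducible_def)
  moreover obtain j i where j: "j \<in> J" and i: "i \<in> {1..m} - J"
    using J by blast
  then have "Q ** P j = P j" "Q ** P i = 0"
    using proj_partition_sum_mult[OF P J(1)] J(1) by (auto simp: Q_def)
  moreover have "P j \<noteq> 0" "P i \<noteq> 0"
    using P J(1) i j by (auto simp: proj_partition_def nontrivial_projection_def)
  ultimately show False
    by auto
qed

lemma block_dim_sum_ge_if_proj_irreducible:
  assumes S: "quantum_graph S" and irr: "proj_irreducible S" and P: "proj_partition m P"
  shows "2 * (m - 1) \<le> block_dim_sum S m P"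
proof -
  define E where "E i j \<longleftrightarrow> i \<in> {1..m} \<and> j \<in> {1..m} \<and> (\<exists>A\<in>S. P j ** A ** P i \<noteq> 0)"
    for i j
  have sym: "E j i" if ij: "E i j" for i j
  proof -
    obtain A where A: "A \<in> S" "P j ** A ** P i \<noteq> 0" and i: "i \<in> {1..m}" and j: "j \<in> {1..m}"
      using ij by (auto simp: E_def)
    have "adj (P j ** A ** P i) = P i ** adj A ** P j"
      using P i j
      by (simp add: adj_mult matrix_mul_assoc proj_partition_def nontrivial_projection_def
          is_projection_def)
    then have "P i ** adj A ** P j \<noteq> 0"
      using A(2) by (metis adj_eq_0_iff)
    moreover have "adj A \<in> S"
      using S A(1) by (simp add: quantum_graph_def)
    ultimately show ?thesis
      using i j by (auto simp: E_def)
  qed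
  have conn: "\<exists>j\<in>J. \<exists>i\<in>{1..m} - J. E i j"
    if J: "J \<subseteq> {1..m}" "J \<noteq> {}" "J \<noteq> {1..m}" for J
  proof -
    obtain j i A where "j \<in> J" "i \<in> {1..m} - J" "A \<in> S" "P j ** A ** P i \<noteq> 0"
      using proj_partition_cut_edge[OF S irr P J] by blast
    moreover have "E i j"
      using calculation J(1) by (auto simp: E_def)
    ultimately show ?thesis
      by blast
  qed
  have edge: "1 \<le> cdim (sandwich (P j) S (P i))" if "E i j" for i j
  proof -
    have "\<not> sandwich (P j) S (P i) \<subseteq> {0}"
      using that by (auto simp: E_def sandwich_def)
    then show ?thesis
      by (simp add: Suc_le_eq flip: cdim_eq_0_iff)
  qed
  have "2 * (m - 1) \<le> card (arcs E {1..m})"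
    using connected_graph_card_arcs[of "{1..m}" E] sym conn by simp
  also have "\<dots> = (\<Sum>(i, j)\<in>arcs E {1..m}. 1)"
    by simp
  also have "\<dots> \<le> (\<Sum>(i, j)\<in>arcs E {1..m}. cdim (sandwich (P j) S (P i)))"
    by (rule sum_mono) (auto simp: arcs_def edge[unfolded One_nat_def])
  also have "\<dots> \<le> block_dim_sum S m P"
    unfolding block_dim_sum_def
    by (rule sum_mono2) (auto simp: arcs_def intro: finite_subset[of _ "{1..m} \<times> {1..m}"])
  finally show ?thesis .
qed

lemma two_block_partition:
  assumes "nontrivial_projection Q"
  shows "proj_partition 2 (\<lambda>i. if i = 1 then Q else mat 1 - Q)"
proof -
  have "{1..2::nat} = {1, 2}"
    by auto
  moreover have "(mat 1 - Q) ** (mat 1 - Q) = mat 1 - Q" "Q ** (mat 1 - Q) = 0"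
    "(mat 1 - Q) ** Q = 0" "adj (mat 1 - Q) = mat 1 - Q"
    using assms by (simp_all add: nontrivial_projection_def is_projection_def
        matrix_diff_ldistrib matrix_diff_rdistrib adj_diff)
  ultimately show ?thesis
    using assms by (auto simp: proj_partition_def nontrivial_projection_def is_projection_def)
qed

lemma block_dim_sum_two_blocks_eq_0:
  assumes Q: "is_projection Q" and comm: "\<forall>A\<in>S. Q ** A = A ** Q"
  shows "block_dim_sum S 2 (\<lambda>i. if i = 1 then Q else mat 1 - Q) = 0"
proof -
  have "{(i, j). i \<in> {1..2::nat} \<and> j \<in> {1..2} \<and> i \<noteq> j} = {(1, 2), (2, 1)}"
    by auto
  moreover have "Q ** A ** (mat 1 - Q) = 0" "(mat 1 - Q) ** A ** Q = 0" if "A \<in> S" for A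
    using Q comm that
    by (simp_all add: matrix_diff_ldistrib matrix_diff_rdistrib is_projection_def)
      (metis matrix_mul_assoc)+
  ultimately show ?thesis
    by (auto simp: block_dim_sum_def cdim_eq_0_iff sandwich_def)
qed

lemma proj_irreducible_iff_block_dim_sum_ge:
  assumes "quantum_graph S"
  shows "proj_irreducible S \<longleftrightarrow> (\<forall>m P. proj_partition m P \<longrightarrow> 2 * (m - 1) \<le> block_dim_sum S m P)"
proof
  assume "\<forall>m P. proj_partition m P \<longrightarrow> 2 * (m - 1) \<le> block_dim_sum S m P"
  then show "proj_irreducible S"
    using two_block_partition block_dim_sum_two_blocks_eq_0
    by (fastforce simp: proj_irreducible_def nontrivial_projection_def)
qed (use assms block_dim_sum_ge_if_proj_irreducible in blast)

theorem theorem3p5: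
  fixes S :: "'n::finite cmat set"
  assumes "quantum_graph S"
  shows "qconnected S \<longleftrightarrow>
    (\<forall>(m::nat) (P :: nat \<Rightarrow> 'n cmat).
       (\<forall>i\<in>{1..m}. nontrivial_projection (P i))
       \<longrightarrow> (\<forall>i\<in>{1..m}. \<forall>j\<in>{1..m}. i \<noteq> j \<longrightarrow> P i ** P j = 0)
       \<longrightarrow> (\<Sum>i\<in>{1..m}. P i) = mat 1
       \<longrightarrow> (\<Sum>(i, j)\<in>{(i, j). i \<in> {1..m} \<and> j \<in> {1..m} \<and> i \<noteq> j}.
              cdim (sandwich (P j) S (P i))) \<ge> 2 * (m - 1))"
proof -
  have "qconnected S \<longleftrightarrow> proj_irreducible S"
    using assms qconnected_imp_proj_irreducible proj_irreducible_imp_qconnected by blast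
  also have "\<dots> \<longleftrightarrow> (\<forall>m P. proj_partition m P \<longrightarrow> 2 * (m - 1) \<le> block_dim_sum S m P)"
    by (rule proj_irreducible_iff_block_dim_sum_ge[OF assms])
  finally show ?thesis
    by (simp only: proj_partition_def block_dim_sum_def imp_conjL)
qed

end
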